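(* Let $N\ge 1$, let $|\cdot|:\mathbb{Z}_N\to\mathbb{R}_{\ge 0}$ satisfy $|0|=0$ and $|k|=|-k|$ for all $k\in\mathbb{Z}_N$, and let $p_i(t)$ ($i\in\mathbb{Z}_N$, $t\ge 0$) be the coefficients in the decomposition $P_t=\sum_{i\in\mathbb{Z}_N}p_i(t)\,\sigma_i$ of the semigroup $P_t$ associated with $|\cdot|$, so that each $p_i$ is a linear combination of the exponentials $e^{-t|k|}$, $k\in\mathbb{Z}_N$, and $p_0(0)=1$, $p_i(0)=0$ for $i\ne 0$. If $p_i'(0)\ge 0$ for all $i\in\mathbb{Z}_N$ with $i\neq 0$ (a finite set of linear inequalities in the values $|k|$, $k\in\mathbb{Z}_N$), then $p_j(t)\ge 0$ for all $j\in\mathbb{Z}_N$ and all $t\ge 0$.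
   Context: Let $\mathcal{L}\mathbb{Z}_N$ be the complex group algebra of the cyclic group $\mathbb{Z}_N$ (written additively, identity $0$), with basis $\{|k\rangle : k\in\mathbb{Z}_N\}$ (ket notation for the group element basis). The semigroup $(P_t)_{t\ge 0}$ associated with $|\cdot|$ consists of the linear operators on $\mathcal{L}\mathbb{Z}_N$ defined by $P_t|k\rangle=e^{-t|k|}\,|k\rangle$ (here $|k|$ in the exponent is the value of the function $|\cdot|$ at $k$). For $i\in\mathbb{Z}_N$ the operator $\sigma_i$ is defined by $\sigma_i|k\rangle=q^{ik}|k\rangle$, where $q=\exp(2\pi i_0/N)$ and $i_0=\sqrt{-1}$. The $\sigma_i$ are mutually orthogonal with respect to $\langle a,b\rangle=\mathrm{Tr}(a^*b)$, and the coefficients $p_i(t)$ are the uniquely determined numbers with $P_t=\sum_{i\in\mathbb{Z}_N}p_i(t)\sigma_i$, i.e. $e^{-t|k|}=\sum_{i\in\mathbb{Z}_N}p_i(t)q^{ik}$ for all $k\in\mathbb{Z}_N$. They are real because $|k|=|-k|$. The derivative $p_i'(0)$ is the derivative in $t$ at $t=0$ (one-sided, or of the evident extension of the exponential formula to all real $t$). *)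

theory Defs
  imports
    "HOL-Analysis.Analysis"
    "HOL-Library.Poly_Mapping"
    "HOL-Library.Complex_Order"
    "Berlekamp_Zassenhaus.Finite_Field"
begin

text \<open>
  The cyclic group of order \<open>N = CARD('n)\<close> is the additive group of \<open>'n mod_ring\<close>, for an
  arbitrary finite index type \<open>'n\<close>; \<open>N = 1\<close> is included.  Its complex group algebra is the type
  \<open>'n mod_ring \<Rightarrow>\<^sub>0 complex\<close>, whose multiplication in \<open>Poly_Mapping\<close> is convolution.

  Inequalities between complex numbers are those of \<open>Complex_Order\<close>: \<open>0 \<le> z\<close> holds iff \<open>z\<close>
  is real and nonnegative.
\<close>

type_synonym 'n cyclic_algebra = "'n mod_ring \<Rightarrow>\<^sub>0 complex"

definition ket :: "'n::finite mod_ring \<Rightarrow> 'n cyclic_algebra"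
  where "ket k = Poly_Mapping.single k 1"

definition kscale :: "complex \<Rightarrow> 'n::finite cyclic_algebra \<Rightarrow> 'n cyclic_algebra"
  where "kscale c v = Poly_Mapping.map ((*) c) v"

text \<open>The linear operator with prescribed values \<open>f k\<close> on the basis vectors \<open>ket k\<close>.\<close>

definition linear_extension ::
    "('n::finite mod_ring \<Rightarrow> 'n cyclic_algebra) \<Rightarrow> 'n cyclic_algebra \<Rightarrow> 'n cyclic_algebra"
  where "linear_extension f v = (\<Sum>k\<in>UNIV. kscale (Poly_Mapping.lookup v k) (f k))"

definition semigroup_op ::
    "('n::finite mod_ring \<Rightarrow> real) \<Rightarrow> real \<Rightarrow> 'n cyclic_algebra \<Rightarrow> 'n cyclic_algebra"
  where "semigroup_op len t =
    linear_extension (\<lambda>k. kscale (complex_of_real (exp (- t * len k))) (ket k))"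

text \<open>
  The factor \<open>q\<^sup>i\<^sup>k\<close> is computed with the representatives of \<open>i\<close> and \<open>k\<close> in \<open>{0..<N}\<close>;
  as \<open>q\<close> is an \<open>N\<close>-th root of unity, it depends on the residue classes only.
\<close>

definition sigma_op :: "'n::finite mod_ring \<Rightarrow> 'n cyclic_algebra \<Rightarrow> 'n cyclic_algebra"
  where "sigma_op i =
    (let q = exp (2 * complex_of_real pi * \<i> / of_nat CARD('n))
     in linear_extension (\<lambda>k. kscale (q powi (to_int_mod_ring i * to_int_mod_ring k)) (ket k)))"

lemma lookup_kscale [simp]: "Poly_Mapping.lookup (kscale c v) k = c * Poly_Mapping.lookup v k"
  unfolding kscale_def by (simp add: Poly_Mapping.map.rep_eq when_def)

lemma linear_linear_extension:
  "Vector_Spaces.linear kscale kscale (linear_extension f)"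
  unfolding Vector_Spaces.linear_def vector_space_def module_hom_def module_hom_axioms_def
    Modules.module_def linear_extension_def
  by (auto intro!: poly_mapping_eqI
      simp: lookup_add lookup_sum algebra_simps sum.distrib sum_distrib_left)

lemma linear_extension_ket [simp]: "linear_extension f (ket k) = f k"
  unfolding linear_extension_def ket_def
  by (rule poly_mapping_eqI)
    (simp add: lookup_sum lookup_single when_def if_distrib [where f = "\<lambda>c. c * _"] cong: if_cong)

lemma semigroup_op_ket:
  "semigroup_op len t (ket k) = kscale (complex_of_real (exp (- t * len k))) (ket k)"
  by (simp add: semigroup_op_def)

end

theory Submission
  imports Defs
begin

text \<open>
  Comparing diagonal entries, the decomposition of the semigroup says that \<open>p j t\<close> is the \<open>j\<close>-th
  Fourier coefficient of the function \<open>k \<mapsto> exp (- t * len k)\<close> on the cyclic group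
  (\<open>fourier_character_sum\<close>).  Differentiating at \<open>0\<close>, the hypothesis becomes: \<open>- len\<close> has
  nonnegative Fourier coefficients away from \<open>0\<close>.  The conclusion is then the finite form of
  Schoenberg's theorem: the exponential of a conditionally positive definite function is positive
  definite.

  The functions with nonnegative Fourier coefficients form a closed convex cone, which is also
  closed under products, since the Fourier transform turns these into convolutions
  (\<open>fourier_mult\<close>).  Hence the power series of \<open>exp\<close> preserves the cone
  (\<open>positive_definite_exp\<close>).  The function \<open>- len\<close> itself need not be in the cone because its
  coefficient at \<open>0\<close>, its mean, is at most \<open>0\<close>.  Adding a real constant \<open>c\<close> repairs exactly this
  coefficient, and it changes \<open>exp (- t * len k)\<close> only by the positive factor \<open>exp (t * c)\<close>
  (\<open>conditionally_positive_definite_exp\<close>).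
\<close>

section \<open>Fourier analysis on the cyclic group\<close>

definition character :: "'n::finite mod_ring \<Rightarrow> 'n mod_ring \<Rightarrow> complex"
  where "character i k =
    exp (2 * complex_of_real pi * \<i> / of_nat CARD('n)) powi (to_int_mod_ring i * to_int_mod_ring k)"

lemma primitive_root_powi_eq_1_iff:
  fixes m :: int
  assumes "0 < N"
  shows "exp (2 * complex_of_real pi * \<i> / of_nat N) powi m = 1 \<longleftrightarrow> int N dvd m"
proof -
  have "exp (2 * complex_of_real pi * \<i> / of_nat N) powi m = 1
      \<longleftrightarrow> (\<exists>n::int. of_int m * (2 * pi) / real N = of_int (2 * n) * pi)"
    by (simp add: exp_power_int exp_eq_1)
  also have "\<dots> \<longleftrightarrow> (\<exists>n::int. real_of_int m = of_int (int N * n))"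
    using assms by (simp add: field_simps)
  also have "\<dots> \<longleftrightarrow> int N dvd m"
    unfolding of_int_eq_iff dvd_def ..
  finally show ?thesis .
qed

lemma primitive_root_powi_cong:
  fixes a b :: int
  assumes "0 < N" and "a mod int N = b mod int N"
  shows "exp (2 * complex_of_real pi * \<i> / of_nat N) powi a
    = exp (2 * complex_of_real pi * \<i> / of_nat N) powi b"
proof -
  let ?q = "exp (2 * complex_of_real pi * \<i> / of_nat N)"
  have "?q powi (a - b) = 1"
    using assms by (simp only: primitive_root_powi_eq_1_iff mod_eq_dvd_iff)
  then show ?thesis
    by (simp add: power_int_diff)
qed

lemma character_commute: "character i k = character k i"
  by (simp add: character_def mult.commute)

lemma character_0 [simp]: "character 0 k = 1" "character k 0 = 1"
  by (simp_all add: character_def)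

text \<open>
  The representative of \<open>i + j\<close> is reduced modulo \<open>N\<close>; this is harmless as \<open>q\<close> is an \<open>N\<close>-th root
  of unity.
\<close>

lemma character_add_left: "character (i + j) k = character i k * character j k"
proof -
  let ?q = "exp (2 * complex_of_real pi * \<i> / of_nat CARD('a))"
  have "character (i + j) k
      = ?q powi (to_int_mod_ring i * to_int_mod_ring k + to_int_mod_ring j * to_int_mod_ring k)"
    unfolding character_def to_int_mod_ring_add
    by (rule primitive_root_powi_cong) (simp_all add: mod_mult_left_eq distrib_right)
  then show ?thesis
    by (simp add: character_def power_int_add)
qed

lemma character_add_right: "character k (i + j) = character k i * character k j"
  by (metis character_commute character_add_left)

text \<open>
  A nontrivial character differs from \<open>1\<close> at the class of \<open>1\<close>; translating the summation variable
  by that class multiplies the sum by a factor other than \<open>1\<close>, so the sum vanishes.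
\<close>

lemma sum_character:
  fixes i :: "'n::finite mod_ring"
  shows "(\<Sum>k\<in>UNIV. character i k) = (if i = 0 then of_nat CARD('n) else 0)"
proof (cases "i = 0")
  case False
  let ?l = "of_int_mod_ring 1 :: 'n mod_ring"
  let ?m = "to_int_mod_ring i"
  have m: "0 < ?m" "?m < int CARD('n)"
    using False range_to_int_mod_ring[where 'a='n] rangeI[of to_int_mod_ring i]
    by (auto simp: order.order_iff_strict)
  then have "to_int_mod_ring ?l = 1"
    by (intro to_int_mod_ring_of_int_mod_ring) auto
  then have ne: "character i ?l \<noteq> 1"
    using m by (auto simp: character_def primitive_root_powi_eq_1_iff dest: zdvd_imp_le)
  have "(\<Sum>k\<in>UNIV. character i k) = (\<Sum>k\<in>UNIV. character i (?l + k))"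
    by (rule sum.reindex_bij_witness[of _ "\<lambda>k. ?l + k" "\<lambda>k. k - ?l"]) auto
  also have "\<dots> = character i ?l * (\<Sum>k\<in>UNIV. character i k)"
    by (simp add: character_add_right sum_distrib_left)
  finally show ?thesis
    using ne False by simp
qed simp

text \<open>
  The coefficient is computed with \<open>character (- j)\<close>, the complex conjugate of \<open>character j\<close>, so
  that only the homomorphism property of the characters enters the calculations.
\<close>

definition fourier :: "('n::finite mod_ring \<Rightarrow> complex) \<Rightarrow> 'n mod_ring \<Rightarrow> complex"
  where "fourier f j = (\<Sum>k\<in>UNIV. f k * character (- j) k) / of_nat CARD('n)"

lemma fourier_inversion:
  fixes f :: "'n::finite mod_ring \<Rightarrow> complex"
  shows "f k = (\<Sum>j\<in>UNIV. fourier f j * character j k)"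
proof -
  have character_minus_mult: "character (- j) l * character j k = character (k - l) j"
    for j l :: "'n mod_ring"
  proof -
    have "character (- j) l = character (- l) j"
    proof -
      have "character (- j) l * character j l = 1" "character (- l) j * character l j = 1"
        by (simp_all flip: character_add_left)
      then show ?thesis
        by (metis character_commute mult_cancel_right mult_zero_right zero_neq_one)
    qed
    then show ?thesis
      by (metis character_add_left character_commute mult.commute uminus_add_conv_diff add.commute)
  qed
  have "(\<Sum>j\<in>UNIV. fourier f j * character j k)
      = (\<Sum>j\<in>UNIV. \<Sum>l\<in>UNIV. f l * character (k - l) j / of_nat CARD('n))"
    by (simp add: fourier_def sum_distrib_right sum_divide_distrib mult.assoc
        flip: character_minus_mult)
  also have "\<dots> = (\<Sum>l\<in>UNIV. f l * (\<Sum>j\<in>UNIV. character (k - l) j) / of_nat CARD('n))"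
    by (subst sum.swap) (simp add: sum_distrib_left sum_divide_distrib)
  also have "\<dots> = (\<Sum>l\<in>UNIV. if k = l then f l else 0)"
    by (rule sum.cong) (auto simp: sum_character)
  finally show ?thesis
    by simp
qed

text \<open>
  Orthogonality of the characters: coefficients in an expansion by characters are unique.
\<close>

lemma fourier_character_sum:
  "fourier (\<lambda>k. \<Sum>i\<in>UNIV. c i * character i k) j = c j"
proof -
  have "fourier (\<lambda>k. \<Sum>i\<in>UNIV. c i * character i k) j
      = (\<Sum>k\<in>UNIV. \<Sum>i\<in>UNIV. c i * character (i - j) k) / of_nat CARD('a)"
    by (simp add: fourier_def sum_distrib_right mult.assoc flip: character_add_left)
  also have "\<dots> = (\<Sum>i\<in>UNIV. c i * (\<Sum>k\<in>UNIV. character (i - j) k)) / of_nat CARD('a)"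
    by (subst sum.swap) (simp add: sum_distrib_left)
  also have "\<dots> = (\<Sum>i\<in>UNIV. if i = j then c i * of_nat CARD('a) else 0) / of_nat CARD('a)"
    by (intro arg_cong2[where f = "(/)"] sum.cong) (auto simp: sum_character)
  finally show ?thesis
    by simp
qed

lemma fourier_add: "fourier (\<lambda>k. f k + g k) j = fourier f j + fourier g j"
  by (simp add: fourier_def sum.distrib add_divide_distrib distrib_right)

lemma fourier_scale: "fourier (\<lambda>k. c * f k) j = c * fourier f j"
  by (simp add: fourier_def sum_distrib_left mult.assoc)

lemma fourier_const: "fourier (\<lambda>k. c) j = (if j = 0 then c else 0)"
  by (simp add: fourier_def sum_character flip: sum_distrib_left)

text \<open>
  Expanding \<open>f\<close> by characters reduces the claim to a product with a single character, which
  translates the Fourier transform of \<open>g\<close>.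
\<close>

lemma fourier_mult:
  "fourier (\<lambda>k. f k * g k) j = (\<Sum>i\<in>UNIV. fourier f i * fourier g (j - i))"
proof -
  have shift: "character i k * character (- j) k = character (- (j - i)) k" for i k
    by (simp flip: character_add_left)
  have "fourier (\<lambda>k. f k * g k) j
      = (\<Sum>k\<in>UNIV. (\<Sum>i\<in>UNIV. fourier f i * character i k) * g k * character (- j) k)
        / of_nat CARD('a)"
    unfolding fourier_def[of "\<lambda>k. f k * g k"] by (simp flip: fourier_inversion)
  also have "\<dots> = (\<Sum>k\<in>UNIV. \<Sum>i\<in>UNIV. fourier f i * (g k * character (- (j - i)) k))
        / of_nat CARD('a)"
    unfolding sum_distrib_right shift[symmetric] by (simp add: mult_ac)
  also have "\<dots> = (\<Sum>i\<in>UNIV. fourier f i * fourier g (j - i))"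
    by (subst sum.swap) (simp add: fourier_def sum_distrib_left sum_divide_distrib)
  finally show ?thesis .
qed

lemma fourier_tendsto:
  assumes "\<And>k. ((\<lambda>x. f x k) \<longlongrightarrow> g k) F"
  shows "((\<lambda>x. fourier (f x) j) \<longlongrightarrow> fourier g j) F"
  unfolding fourier_def by (intro tendsto_intros assms) simp

lemma fourier_has_vector_derivative:
  assumes "\<And>k. ((\<lambda>x. f x k) has_vector_derivative f' k) F"
  shows "((\<lambda>x. fourier (f x) j) has_vector_derivative fourier f' j) F"
  unfolding fourier_def
  by (intro has_vector_derivative_divide has_vector_derivative_sum has_vector_derivative_mult_left
      assms)

section \<open>Functions with nonnegative Fourier coefficients\<close>

text \<open>
  By Bochner's theorem for the finite cyclic group, this is positive definiteness in the usual
  sense, that is, positivity of the quadratic forms with the kernel \<open>f (k - l)\<close>.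
\<close>

definition positive_definite :: "('n::finite mod_ring \<Rightarrow> complex) \<Rightarrow> bool"
  where "positive_definite f \<longleftrightarrow> (\<forall>j. 0 \<le> fourier f j)"

lemma positive_definite_mult:
  assumes "positive_definite f" "positive_definite g"
  shows "positive_definite (\<lambda>k. f k * g k)"
  using assms by (auto simp: positive_definite_def fourier_mult intro!: sum_nonneg mult_nonneg_nonneg)

lemma positive_definite_scale:
  assumes "0 \<le> c" "positive_definite f"
  shows "positive_definite (\<lambda>k. c * f k)"
  using assms by (auto simp: positive_definite_def fourier_scale intro!: mult_nonneg_nonneg)

lemma positive_definite_power:
  assumes "positive_definite f"
  shows "positive_definite (\<lambda>k. f k ^ n)"
proof (induction n)
  case 0
  show ?case by (simp add: positive_definite_def fourier_const less_eq_complex_def)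
next
  case (Suc n)
  then show ?case using assms by (simp add: positive_definite_mult)
qed

lemma positive_definite_sum:
  assumes "\<And>x. x \<in> A \<Longrightarrow> positive_definite (f x)"
  shows "positive_definite (\<lambda>k. \<Sum>x\<in>A. f x k)"
  using assms
proof (induction A rule: infinite_finite_induct)
  case (insert x A)
  then show ?case by (auto simp: positive_definite_def fourier_add intro: add_nonneg_nonneg)
qed (simp_all add: positive_definite_def fourier_const)

lemma positive_definite_tendsto:
  assumes "\<And>k. ((\<lambda>x. f x k) \<longlongrightarrow> g k) F" "F \<noteq> bot" "\<And>x. positive_definite (f x)"
  shows "positive_definite g"
  unfolding positive_definite_def
proof
  fix j
  have "fourier g j \<in> \<real>\<^sub>\<ge>\<^sub>0"
  proof (rule Lim_in_closed_set[OF closed_nonneg_Reals_complex _ \<open>F \<noteq> bot\<close>])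
    show "((\<lambda>x. fourier (f x) j) \<longlongrightarrow> fourier g j) F"
      using assms(1) by (rule fourier_tendsto)
    show "\<forall>\<^sub>F x in F. fourier (f x) j \<in> \<real>\<^sub>\<ge>\<^sub>0"
      using assms(3) by (auto simp: positive_definite_def complex_nonneg_Reals_iff less_eq_complex_def)
  qed
  then show "0 \<le> fourier g j"
    by (simp add: complex_nonneg_Reals_iff less_eq_complex_def)
qed

text \<open>
  The partial sums of the exponential series are polynomials in \<open>f\<close> with nonnegative
  coefficients, and nonnegativity passes to the limit.
\<close>

lemma positive_definite_exp:
  assumes "positive_definite f"
  shows "positive_definite (\<lambda>k. exp (f k))"
proof (rule positive_definite_tendsto[where F = sequentially])
  show "(\<lambda>m. \<Sum>n<m. complex_of_real (inverse (fact n)) * f k ^ n) \<longlonglongrightarrow> exp (f k)" for k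
    using exp_converges[of "f k"] by (simp add: sums_def scaleR_conv_of_real)
  show "positive_definite (\<lambda>k. \<Sum>n<m. complex_of_real (inverse (fact n)) * f k ^ n)" for m
    by (intro positive_definite_sum positive_definite_scale positive_definite_power assms)
      (simp add: less_eq_complex_def)
qed simp

text \<open>
  As \<open>g\<close> is real-valued, so is its mean, the Fourier coefficient at \<open>0\<close>.  After
  subtraction of the mean, all Fourier coefficients are nonnegative; the exponential of the mean is
  a positive factor that can be restored afterwards.
\<close>

lemma conditionally_positive_definite_exp:
  fixes g :: "'n::finite mod_ring \<Rightarrow> real"
  assumes "\<And>j. j \<noteq> 0 \<Longrightarrow> 0 \<le> fourier (\<lambda>k. complex_of_real (g k)) j" and "0 \<le> t"
  shows "positive_definite (\<lambda>k. complex_of_real (exp (t * g k)))"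
proof -
  let ?f = "\<lambda>k. complex_of_real (g k)"
  \<comment> \<open>Adding \<open>c\<close> makes the Fourier coefficient at \<open>0\<close> vanish.\<close>
  define c where "c = - (\<Sum>k\<in>UNIV. g k) / real CARD('n)"
  have c: "fourier ?f 0 = - complex_of_real c"
    by (simp add: fourier_def c_def)
  have "positive_definite (\<lambda>k. ?f k + complex_of_real c)"
    using assms(1) by (simp add: positive_definite_def fourier_add fourier_const c)
  then have "positive_definite (\<lambda>k. complex_of_real (exp (- (t * c))) *
      exp (complex_of_real t * (?f k + complex_of_real c)))"
    by (intro positive_definite_scale positive_definite_exp)
      (use \<open>0 \<le> t\<close> in \<open>simp_all add: less_eq_complex_def\<close>)
  moreover have "complex_of_real (exp (- (t * c))) *
      exp (complex_of_real t * (?f k + complex_of_real c)) = complex_of_real (exp (t * g k))" for k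
    by (simp add: distrib_left flip: exp_of_real exp_add)
  ultimately show ?thesis
    by simp
qed

section \<open>The semigroup\<close>

lemma lookup_semigroup_op_ket:
  "Poly_Mapping.lookup (semigroup_op len t (ket k)) k = complex_of_real (exp (- t * len k))"
  by (simp add: semigroup_op_ket) (simp add: ket_def)

lemma lookup_sigma_op_ket: "Poly_Mapping.lookup (sigma_op i (ket k)) k = character i k"
  by (simp add: sigma_op_def character_def Let_def) (simp add: ket_def)

theorem corollary2p2:
  fixes len :: "'n::finite mod_ring \<Rightarrow> real"
    and p :: "'n mod_ring \<Rightarrow> real \<Rightarrow> complex"
  assumes len_nonneg: "\<And>k. 0 \<le> len k"
    and len_zero: "len 0 = 0"
    and len_minus: "\<And>k. len (- k) = len k"
    and decomposition:
      "\<And>t. 0 \<le> t \<Longrightarrow> semigroup_op len t = (\<lambda>v. \<Sum>i\<in>UNIV. kscale (p i t) (sigma_op i v))"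
    and derivative_nonneg:
      "\<And>i. i \<noteq> 0 \<Longrightarrow> 0 \<le> vector_derivative (p i) (at 0 within {0..})"
  shows "\<forall>j. \<forall>t\<ge>0. 0 \<le> p j t"
proof -
  \<comment> \<open>Both sides of the decomposition are diagonal in the basis \<open>ket k\<close>.\<close>
  have p_eq: "p j t = fourier (\<lambda>k. complex_of_real (exp (- t * len k))) j" if "0 \<le> t" for j t
  proof -
    have "complex_of_real (exp (- t * len k)) = (\<Sum>i\<in>UNIV. p i t * character i k)" for k
      unfolding lookup_semigroup_op_ket[symmetric] decomposition[OF that]
      by (simp add: lookup_sum lookup_sigma_op_ket)
    then show ?thesis
      by (simp only: fourier_character_sum)
  qed
  have "0 \<le> fourier (\<lambda>k. complex_of_real (- len k)) j" if "j \<noteq> 0" for j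
  proof -
    have "((\<lambda>t. fourier (\<lambda>k. complex_of_real (exp (- t * len k))) j)
        has_vector_derivative fourier (\<lambda>k. complex_of_real (- len k)) j) (at 0 within {0..})"
    proof (rule fourier_has_vector_derivative)
      fix k
      have "((\<lambda>t. exp (- t * len k)) has_real_derivative - len k) (at 0 within {0..})"
        by (auto intro!: derivative_eq_intros)
      then show "((\<lambda>t. complex_of_real (exp (- t * len k))) has_vector_derivative
          complex_of_real (- len k)) (at 0 within {0..})"
        by (intro has_vector_derivative_of_real)
          (simp add: has_real_derivative_iff_has_vector_derivative)
    qed
    then have "(p j has_vector_derivative fourier (\<lambda>k. complex_of_real (- len k)) j)
        (at 0 within {0..})"
      by (rule has_vector_derivative_transform[rotated 2]) (simp_all add: p_eq)
    moreover have "at (0::real) within {0..} \<noteq> bot"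
      by (simp add: at_within_Ici_at_right)
    ultimately show ?thesis
      using derivative_nonneg[OF that] by (metis vector_derivative_within)
  qed
  then have "positive_definite (\<lambda>k. complex_of_real (exp (t * - len k)))" if "0 \<le> t" for t
    using that by (rule conditionally_positive_definite_exp)
  then show ?thesis
    by (simp add: p_eq positive_definite_def)
qed

end
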